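(* Let $\sigma=(\sigma_1,\dots,\sigma_l)$, $l\ge 1$, be a node of the PE-B\&B tree, and let $A_\sigma=T_{\sigma_l}\cup\left(\bigcup_{j\in\overline{J}_\sigma}T_j\right)$. A valid lower bound on the optimal value of the subproblem associated with node $\sigma$ is $$L_4(\sigma)=z(\sigma)+|A_\sigma|-\min\{c,s_\sigma\},\qquad\text{where}\qquad s_\sigma=\left|T_\sigma\cap A_\sigma\right|+\max\left\{c-\left|T_\sigma\right|,0\right\}.$$ That is, $L_4(\sigma)\le z(\overline{\sigma})$ for every completion $\overline{\sigma}$ of $\sigma$.
   Context: Job Sequencing and Tool Switching Problem (SSP). We are given tools $T=\{1,\dots,m\}$, jobs $J=\{1,\dots,n\}$, a magazine capacity $c<m$, and for each job $j\in J$ a required toolset $T_j\subseteq T$ with $|T_j|\le c$. Every tool is required by some job: $T=\bigcup_{j\in J}T_j$. A (partial) sequence $\sigma=(\sigma_1,\dots,\sigma_l)$ consists of pairwise distinct jobs. Let $J_\sigma=\{\sigma_1,\dots,\sigma_l\}$, $\overline{J}_\sigma=J\setminus J_\sigma$, and $T_\sigma=\bigcup_{j\in J_\sigma}T_j$. A magazine configuration is a set $M\subseteq T$ with $|M|=c$. A sequence of magazine configurations $\mathcal{M}=(M_1,\dots,M_l)$ covers $\sigma$ if $T_{\sigma_i}\subseteq M_i$ for $i=1,\dots,l$. Its number of tool switches is $z(\mathcal{M})=\sum_{i=2}^{l}|M_i\setminus M_{i-1}|$ (so the initial loading is free). Let $z(\sigma)$ be the minimum of $z(\mathcal{M})$ over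 all $\mathcal{M}$ covering $\sigma$. The SSP asks for a permutation of $J$ minimizing $z$. PE-B\&B tree. The root is the empty sequence; the children of a node $\sigma$ are the sequences obtained by appending one job of $\overline{J}_\sigma$ at the end of $\sigma$ (one child per job). Thus the nodes are all sequences of distinct jobs, and the leaves are the permutations of $J$. A completion of a node $\sigma=(\sigma_1,\dots,\sigma_l)$ is any permutation of $J$ having $\sigma$ as a prefix. The optimal value of the subproblem associated with $\sigma$ is the minimum of $z(\overline{\sigma})$ over all completions $\overline{\sigma}$ of $\sigma$. *)

theory Defs
  imports "HOL-Library.Sublist" "HOL-Combinatorics.Multiset_Permutations"
begin

text \<open>
  Tools are \<open>{1..m}\<close>, jobs are \<open>{1..n}\<close>, \<open>c\<close> is the magazine capacity and \<open>T j\<close> the toolset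
  required by job \<open>j\<close>. Sequences are lists, hence indexed from \<open>0\<close>.
\<close>

definition ssp_instance :: "nat \<Rightarrow> nat \<Rightarrow> nat \<Rightarrow> (nat \<Rightarrow> nat set) \<Rightarrow> bool" where
  "ssp_instance m n c T \<longleftrightarrow>
     c < m \<and>
     (\<forall>j\<in>{1..n}. T j \<subseteq> {1..m} \<and> card (T j) \<le> c) \<and>
     {1..m} = (\<Union>j\<in>{1..n}. T j)"

inductive pe_node :: "nat \<Rightarrow> nat list \<Rightarrow> bool" for n where
  root: "pe_node n []"
| child: "pe_node n \<sigma> \<Longrightarrow> j \<in> {1..n} - set \<sigma> \<Longrightarrow> pe_node n (\<sigma> @ [j])"

definition magazine :: "nat \<Rightarrow> nat \<Rightarrow> nat set \<Rightarrow> bool" where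
  "magazine m c M \<longleftrightarrow> M \<subseteq> {1..m} \<and> card M = c"

definition covers :: "nat \<Rightarrow> nat \<Rightarrow> (nat \<Rightarrow> nat set) \<Rightarrow> nat list \<Rightarrow> nat set list \<Rightarrow> bool" where
  "covers m c T \<sigma> Ms \<longleftrightarrow>
     length Ms = length \<sigma> \<and>
     (\<forall>M\<in>set Ms. magazine m c M) \<and>
     (\<forall>i<length \<sigma>. T (\<sigma> ! i) \<subseteq> Ms ! i)"

definition switches :: "nat set list \<Rightarrow> nat" where
  "switches Ms = (\<Sum>i = 1..<length Ms. card (Ms ! i - Ms ! (i - 1)))"

text \<open>
  For an instance and a sequence of jobs the set of covering magazine sequences is nonempty (see
  \<open>covers_exists\<close> below), so the infimum over the naturals is an attained minimum.
\<close>

definition min_switches :: "nat \<Rightarrow> nat \<Rightarrow> (nat \<Rightarrow> nat set) \<Rightarrow> nat list \<Rightarrow> nat" where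
  "min_switches m c T \<sigma> = Inf (switches ` {Ms. covers m c T \<sigma> Ms})"

definition completions :: "nat \<Rightarrow> nat list \<Rightarrow> nat list set" where
  "completions n \<sigma> = {\<tau> \<in> permutations_of_set {1..n}. prefix \<sigma> \<tau>}"

definition subproblem_opt :: "nat \<Rightarrow> nat \<Rightarrow> nat \<Rightarrow> (nat \<Rightarrow> nat set) \<Rightarrow> nat list \<Rightarrow> nat" where
  "subproblem_opt m n c T \<sigma> = Min (min_switches m c T ` completions n \<sigma>)"

definition used_tools :: "(nat \<Rightarrow> nat set) \<Rightarrow> nat list \<Rightarrow> nat set" where
  "used_tools T \<sigma> = (\<Union>j\<in>set \<sigma>. T j)"

definition active_tools :: "nat \<Rightarrow> (nat \<Rightarrow> nat set) \<Rightarrow> nat list \<Rightarrow> nat set" where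
  "active_tools n T \<sigma> = T (last \<sigma>) \<union> (\<Union>j\<in>{1..n} - set \<sigma>. T j)"

definition s_bound :: "nat \<Rightarrow> nat \<Rightarrow> (nat \<Rightarrow> nat set) \<Rightarrow> nat list \<Rightarrow> int" where
  "s_bound n c T \<sigma> =
     int (card (used_tools T \<sigma> \<inter> active_tools n T \<sigma>)) +
     max (int c - int (card (used_tools T \<sigma>))) 0"

definition L4 :: "nat \<Rightarrow> nat \<Rightarrow> nat \<Rightarrow> (nat \<Rightarrow> nat set) \<Rightarrow> nat list \<Rightarrow> int" where
  "L4 m n c T \<sigma> =
     int (min_switches m c T \<sigma>) + int (card (active_tools n T \<sigma>)) -
     min (int c) (s_bound n c T \<sigma>)"

lemma pe_node_iff: "pe_node n \<sigma> \<longleftrightarrow> distinct \<sigma> \<and> set \<sigma> \<subseteq> {1..n}"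
proof
  assume "pe_node n \<sigma>"
  then show "distinct \<sigma> \<and> set \<sigma> \<subseteq> {1..n}"
    by induction auto
next
  assume "distinct \<sigma> \<and> set \<sigma> \<subseteq> {1..n}"
  then show "pe_node n \<sigma>"
    by (induction \<sigma> rule: rev_induct) (auto intro!: pe_node.intros)
qed

lemma covers_exists:
  assumes inst: "ssp_instance m n c T" and jobs: "set \<sigma> \<subseteq> {1..n}"
  shows "\<exists>Ms. covers m c T \<sigma> Ms"
proof -
  have "\<exists>M. T j \<subseteq> M \<and> magazine m c M" if "j \<in> {1..n}" for j
  proof -
    have "T j \<subseteq> {1..m}" "card (T j) \<le> c" "c < m"
      using inst that unfolding ssp_instance_def by blast+
    then obtain M where "T j \<subseteq> M" "M \<subseteq> {1..m}" "card M = c"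
      using exists_subset_between[of "T j" c "{1..m}"] by auto
    then show ?thesis by (auto simp: magazine_def)
  qed
  then obtain f where f: "\<And>j. j \<in> {1..n} \<Longrightarrow> T j \<subseteq> f j \<and> magazine m c (f j)"
    by metis
  have "covers m c T \<sigma> (map f \<sigma>)"
    unfolding covers_def
  proof (intro conjI ballI allI impI)
    show "magazine m c M" if "M \<in> set (map f \<sigma>)" for M
      using that f jobs by auto
    show "T (\<sigma> ! i) \<subseteq> map f \<sigma> ! i" if "i < length \<sigma>" for i
    proof -
      have "\<sigma> ! i \<in> {1..n}" using jobs nth_mem[OF that] by blast
      then show ?thesis using f that by simp
    qed
  qed simp
  then show ?thesis by blast
qed

lemma completions_finite: "finite (completions n \<sigma>)"
  by (simp add: completions_def)

lemma completions_nonempty: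
  assumes "pe_node n \<sigma>"
  shows "completions n \<sigma> \<noteq> {}"
proof -
  obtain \<rho> where "set \<rho> = {1..n} - set \<sigma>" "distinct \<rho>"
    using finite_distinct_list[of "{1..n} - set \<sigma>"] by auto
  then have "\<sigma> @ \<rho> \<in> completions n \<sigma>"
    using assms by (auto simp: completions_def permutations_of_set_def pe_node_iff)
  then show ?thesis by blast
qed

end

theory Submission
  imports Defs
begin

text \<open>
  Charge for the initial loading too: the load count of a sequence of magazines is the number of
  tool insertions when one starts from the empty magazine, which for nonempty sequences of full
  magazines is the number of switches plus \<open>c\<close>. Unlike the number of switches, the load count still
  behaves well for partially filled magazines: it splits additively over any partition of the
  tools, and it is at least the number of distinct tools that occur.

  Take an optimal magazine sequence for a completion of \<open>\<sigma>\<close>, and let \<open>M\<close> be its magazine at the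
  last job of \<open>\<sigma>\<close>. All tools of \<open>A\<^sub>\<sigma>\<close> outside \<open>M\<close> must be inserted later, so the tail costs at
  least \<open>|A\<^sub>\<sigma>| - |A\<^sub>\<sigma> \<inter> M|\<close>. If \<open>|A\<^sub>\<sigma> \<inter> M|\<close> exceeds \<open>s\<^sub>\<sigma>\<close>, then \<open>M\<close> holds tools that \<open>\<sigma>\<close> never
  uses, and the head must pay for them. Indeed, let \<open>e\<close> be the number of tools in \<open>M\<close> outside
  \<open>T\<^sub>\<sigma>\<close>. Deleting all tools outside \<open>T\<^sub>\<sigma>\<close> from the head saves at least \<open>e\<close> loads. The resulting
  partial magazines can be filled up again (\<open>fill_magazines\<close>), preferably with tools that other
  partial magazines contain, so that only filling in excess of the \<open>|T\<^sub>\<sigma>|\<close> available tools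
  costs anything. Hence the head makes at least \<open>z(\<sigma>) + e - max (c - |T\<^sub>\<sigma>|) 0\<close> switches
  (\<open>switches_ge_unused_tools\<close>). Since \<open>|A\<^sub>\<sigma> \<inter> M| \<le> |T\<^sub>\<sigma> \<inter> A\<^sub>\<sigma>| + e\<close>, head and tail
  together give the bound with \<open>s\<^sub>\<sigma>\<close>; the bound with \<open>c\<close> follows from \<open>|A\<^sub>\<sigma> \<inter> M| \<le> c\<close>,
  as the head makes at least \<open>z(\<sigma>)\<close> switches.
\<close>

section \<open>Load counts\<close>

fun loads :: "'a set \<Rightarrow> 'a set list \<Rightarrow> nat" where
  "loads P [] = 0"
| "loads P (M # Ms) = card (M - P) + loads M Ms"

lemma loads_append: "loads P (Ms @ Ns) = loads P Ms + loads (last (P # Ms)) Ns"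
  by (induction Ms arbitrary: P) auto

lemma switches_Cons: "switches (M # Ms) = loads M Ms"
proof -
  have "(\<Sum>i<length Ms. card (Ms ! i - (M # Ms) ! i)) = loads M Ms"
    by (induction Ms arbitrary: M) (simp_all add: sum.lessThan_Suc_shift del: sum.lessThan_Suc)
  moreover have "switches (M # Ms) = (\<Sum>i<length Ms. card (Ms ! i - (M # Ms) ! i))"
    unfolding switches_def
    by (rule sum.reindex_bij_witness[of _ Suc "\<lambda>i. i - 1"]) auto
  ultimately show ?thesis by simp
qed

lemma switches_append:
  assumes "Ms \<noteq> []"
  shows "switches (Ms @ Ns) = switches Ms + loads (last Ms) Ns"
  using assms by (cases Ms) (simp_all add: switches_Cons loads_append)

lemma loads_eq_switches:
  assumes "Ms \<noteq> []" "\<forall>M\<in>set Ms. card M = c"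
  shows "loads {} Ms = switches Ms + c"
  using assms by (cases Ms) (simp_all add: switches_Cons)

lemma loads_replicate: "loads P (replicate k X) \<le> card (X - P)"
proof -
  have "loads X (replicate i X) = 0" for i by (induction i) auto
  then show ?thesis by (cases k) auto
qed

lemma card_Union_le_loads:
  assumes "\<forall>M\<in>set Ms. finite M"
  shows "card (\<Union> (set Ms) - P) \<le> loads P Ms"
  using assms
proof (induction Ms arbitrary: P)
  case (Cons M Ms)
  have "card (\<Union> (set (M # Ms)) - P) \<le> card ((M - P) \<union> (\<Union> (set Ms) - M))"
    using Cons.prems by (intro card_mono) auto
  also have "\<dots> \<le> card (M - P) + card (\<Union> (set Ms) - M)"
    by (rule card_Un_le)
  finally show ?case using Cons.IH[of M] Cons.prems by simp
qed simp

lemma loads_split: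
  assumes "\<forall>M\<in>set Ms. finite M"
  shows "loads P Ms =
    loads (P \<inter> U) (map (\<lambda>M. M \<inter> U) Ms) + loads (P - U) (map (\<lambda>M. M - U) Ms)"
  using assms
proof (induction Ms arbitrary: P)
  case (Cons M Ms)
  have "card (M - P) = card ((M \<inter> U - P \<inter> U) \<union> (M - U - (P - U)))"
    by (rule arg_cong[of _ _ card]) blast
  also have "\<dots> = card (M \<inter> U - P \<inter> U) + card (M - U - (P - U))"
    using Cons.prems by (intro card_Un_disjoint) auto
  finally show ?case using Cons by simp
qed simp

text \<open>A tool outside \<open>U\<close> in the last magazine was inserted at some point.\<close>

lemma loads_restrict:
  assumes "Ms \<noteq> []" "\<forall>M\<in>set Ms. finite M"
  shows "loads {} (map (\<lambda>M. M \<inter> U) Ms) + card (last Ms - U) \<le> loads {} Ms"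
proof -
  let ?Ds = "map (\<lambda>M. M - U) Ms"
  have "card (last Ms - U) \<le> card (\<Union> (set ?Ds) - {})"
    using assms last_in_set[OF assms(1)] by (intro card_mono) (auto simp del: last_in_set)
  also have "\<dots> \<le> loads {} ?Ds"
    using assms by (intro card_Union_le_loads) auto
  finally show ?thesis using loads_split[OF assms(2), of "{}" U] by simp
qed

section \<open>Filling up partial magazines\<close>

text \<open>
  Filling up is free as long as tools occurring in the sequence suffice: a tool can be inserted
  earlier than needed or kept longer than needed. The proof builds the full magazines from the
  back. As long as the later magazines contain at most \<open>c\<close> tools altogether, a single magazine \<open>X\<close>
  serves all of them. As soon as they contain more, the new first magazine takes its extra tools
  from its successor, which the induction hypothesis has already paid for in full.
\<close>

lemma fill_magazines:
  assumes "finite U" "c \<le> card U" "\<forall>N\<in>set Ns. N \<subseteq> U \<and> card N \<le> c"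
  shows "\<exists>Ps. list_all2 (\<lambda>N P. N \<subseteq> P \<and> P \<subseteq> U \<and> card P = c) Ns Ps \<and>
    loads {} Ps + min c (card (\<Union> (set Ns))) \<le> loads {} Ns + c"
  using assms(3)
proof (induction Ns)
  case Nil
  then show ?case by simp
next
  case (Cons N Ns)
  define R where "R = \<Union> (set Ns)"
  have N: "N \<subseteq> U" "card N \<le> c" "finite N" and R: "R \<subseteq> U" "finite R"
    using Cons.prems finite_subset[OF _ assms(1)] by (auto simp: R_def)
  show ?case
  proof (cases "card R \<le> c")
    case True
    \<comment> \<open>Extra tools for \<open>P\<close> come from \<open>R\<close> first, so that few tools of \<open>R\<close> are left to be
      inserted when \<open>P\<close> is replaced by \<open>X\<close>.\<close>
    have "\<exists>P. N \<subseteq> P \<and> P \<subseteq> U \<and> card P = c \<and> card (R - P) + min c (card (N \<union> R)) \<le> card (N \<union> R)"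
    proof (cases "card (N \<union> R) \<le> c")
      case True
      then obtain P where "N \<union> R \<subseteq> P" "P \<subseteq> U" "card P = c"
        using exists_subset_between[of "N \<union> R" c U] assms N R by auto
      moreover from this have "R - P = {}" by auto
      then have "card (R - P) = 0" by (metis card.empty)
      ultimately show ?thesis by (intro exI[of _ P]) simp
    next
      case False
      then obtain P where P: "N \<subseteq> P" "P \<subseteq> N \<union> R" "card P = c"
        using exists_subset_between[of N c "N \<union> R"] N R by auto
      have "card (R - P) \<le> card (N \<union> R - P)"
        using N R by (intro card_mono) auto
      also have "\<dots> = card (N \<union> R) - c"
        using P N R by (simp add: card_Diff_subset finite_subset[OF P(2)])
      finally show ?thesis using P N R False by (intro exI[of _ P]) auto
    qed
    then obtain P where P: "N \<subseteq> P" "P \<subseteq> U" "card P = c"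
      and le: "card (R - P) + min c (card (N \<union> R)) \<le> card (N \<union> R)" by blast
    have fin: "finite P" using P assms(1) finite_subset by blast
    have "c \<le> card (P \<union> R)"
      using card_mono[of "P \<union> R" P] P fin R by auto
    then obtain X where X: "R \<subseteq> X" "X \<subseteq> P \<union> R" "card X = c"
      using exists_subset_between[of R c "P \<union> R"] True fin R by auto
    let ?Ps = "P # replicate (length Ns) X"
    have "loads {} ?Ps \<le> c + card (X - P)"
      using loads_replicate[of P "length Ns" X] P by simp
    also have "card (X - P) \<le> card (R - P)"
      using X R by (intro card_mono) auto
    finally have "loads {} ?Ps + min c (card (N \<union> R)) \<le> card (N \<union> R) + c"
      using le by simp
    also have "card (N \<union> R) \<le> loads {} (N # Ns)"
      using card_Union_le_loads[of "N # Ns" "{}"] Cons.prems finite_subset[OF _ assms(1)]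
      by (auto simp: R_def)
    finally have "loads {} ?Ps + min c (card (\<Union> (set (N # Ns)))) \<le> loads {} (N # Ns) + c"
      by (simp add: R_def)
    moreover have "list_all2 (\<lambda>N P. N \<subseteq> P \<and> P \<subseteq> U \<and> card P = c) (N # Ns) ?Ps"
    proof -
      have "X \<subseteq> U" using P(2) X(2) R(1) by blast
      moreover have "Ns ! i \<subseteq> X" if "i < length Ns" for i
        using Union_upper[OF nth_mem[OF that]] X(1) unfolding R_def by (rule subset_trans)
      ultimately have
        "list_all2 (\<lambda>N P. N \<subseteq> P \<and> P \<subseteq> U \<and> card P = c) Ns (replicate (length Ns) X)"
        using X(3) by (intro list_all2_all_nthI) simp_all
      then show ?thesis using P by simp
    qed
    ultimately show ?thesis by blast
  next
    case False
    then obtain N' Ns' where Ns: "Ns = N' # Ns'"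
      by (cases Ns) (auto simp: R_def)
    obtain Ps where Ps: "list_all2 (\<lambda>N P. N \<subseteq> P \<and> P \<subseteq> U \<and> card P = c) Ns Ps"
      "loads {} Ps + min c (card R) \<le> loads {} Ns + c"
      using Cons unfolding R_def by auto
    then obtain Q Qs where Q: "Ps = Q # Qs" "N' \<subseteq> Q" "Q \<subseteq> U" "card Q = c"
      by (auto simp: Ns list_all2_Cons1)
    have fin: "finite Q" "finite N'"
      using finite_subset[OF _ assms(1)] Q(2,3) by (simp_all add: subset_trans[OF Q(2)])
    have "c \<le> card (N \<union> Q)"
      using card_mono[of "N \<union> Q" Q] Q fin N by auto
    then obtain P where P: "N \<subseteq> P" "P \<subseteq> N \<union> Q" "card P = c"
      using exists_subset_between[of N c "N \<union> Q"] fin N by auto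
    have finP: "finite P" using P N fin finite_subset by blast
    \<comment> \<open>\<open>P\<close> and \<open>Q\<close> have equal size, so the differences in both directions have equal size, and
      all of \<open>P - Q\<close> comes from \<open>N\<close>.\<close>
    have "card (Q - P) = card (P - Q)"
      using fin finP P Q by (intro order_antisym card_le_sym_Diff) simp_all
    also have "\<dots> \<le> card (N - N')"
      using P Q N by (intro card_mono) auto
    finally have "card (Q - P) + card N' \<le> card (N - N') + card N'" by simp
    also have "\<dots> = card (N' - N) + card N"
      using N(3) fin(2) card_Un_disjoint[of "N - N'" N'] card_Un_disjoint[of "N' - N" N]
      by (simp add: Un_commute Int_commute Diff_disjoint)
    finally have "loads {} (P # Ps) \<le> loads {} (N # Ns)"
      using Ps(2) False P Q by (simp add: Ns)
    moreover have "list_all2 (\<lambda>N P. N \<subseteq> P \<and> P \<subseteq> U \<and> card P = c) (N # Ns) (P # Ps)"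
      using Ps P Q N by auto
    ultimately show ?thesis by (intro exI[of _ "P # Ps"]) auto
  qed
qed

section \<open>Switches on the head and on the tail\<close>

lemma min_switches_le:
  assumes "covers m c T \<sigma> Ms"
  shows "min_switches m c T \<sigma> \<le> switches Ms"
  unfolding min_switches_def using assms by (intro cInf_lower) auto

lemma min_switches_attained:
  assumes "ssp_instance m n c T" "set \<sigma> \<subseteq> {1..n}"
  obtains Ms where "covers m c T \<sigma> Ms" "switches Ms = min_switches m c T \<sigma>"
proof -
  have "min_switches m c T \<sigma> \<in> switches ` {Ms. covers m c T \<sigma> Ms}"
    unfolding min_switches_def using covers_exists[OF assms] by (intro Inf_nat_def1) auto
  then show ?thesis using that by auto
qed

text \<open>
  Ending up with tools that \<open>\<sigma>\<close> never uses is expensive: up to the \<open>c - |T\<^sub>\<sigma>|\<close> slots that are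
  superfluous anyway, each such tool wastes one switch compared to the optimum.
\<close>

lemma switches_ge_unused_tools:
  assumes cov: "covers m c T \<sigma> Ms" and "c \<le> m" "\<sigma> \<noteq> []"
  shows "min_switches m c T \<sigma> + card (last Ms - used_tools T \<sigma>)
    \<le> switches Ms + (c - card (used_tools T \<sigma>))"
proof -
  let ?U = "used_tools T \<sigma>"
  let ?Ns = "map (\<lambda>M. M \<inter> ?U) Ms"
  have len: "length Ms = length \<sigma>"
    and mag: "\<And>M. M \<in> set Ms \<Longrightarrow> M \<subseteq> {1..m} \<and> card M = c"
    and sub: "\<And>i. i < length \<sigma> \<Longrightarrow> T (\<sigma> ! i) \<subseteq> Ms ! i"
    using cov by (auto simp: covers_def magazine_def)
  have ne: "Ms \<noteq> []" using len assms(3) by auto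
  have fin: "finite M" if "M \<in> set Ms" for M
    using mag[OF that] finite_subset by blast
  have used: "?U = \<Union> (set ?Ns)"
    using sub len unfolding used_tools_def by (fastforce simp: in_set_conv_nth)
  have "card (M \<inter> ?U) \<le> c" if "M \<in> set Ms" for M
    using card_mono[OF fin[OF that], of "M \<inter> ?U"] mag[OF that] by auto
  then have "\<forall>N\<in>set ?Ns. N \<subseteq> {1..m} \<and> card N \<le> c"
    using mag by fastforce
  then obtain Ps where
    Ps: "list_all2 (\<lambda>N P. N \<subseteq> P \<and> P \<subseteq> {1..m} \<and> card P = c) ?Ns Ps"
    and le: "loads {} Ps + min c (card ?U) \<le> loads {} ?Ns + c"
    using fill_magazines[of "{1..m}" c ?Ns] assms(2) used by auto
  have lenP: "length Ps = length \<sigma>"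
    using Ps len by (auto dest: list_all2_lengthD)
  have P: "Ms ! i \<inter> ?U \<subseteq> Ps ! i \<and> Ps ! i \<subseteq> {1..m} \<and> card (Ps ! i) = c" if "i < length \<sigma>" for i
    using Ps that len by (auto simp: list_all2_conv_all_nth)
  have magP: "\<forall>M\<in>set Ps. magazine m c M"
    using P lenP unfolding magazine_def by (metis in_set_conv_nth)
  have "T (\<sigma> ! i) \<subseteq> Ps ! i" if "i < length \<sigma>" for i
  proof -
    have "T (\<sigma> ! i) \<subseteq> ?U" using nth_mem[OF that] by (auto simp: used_tools_def)
    then show ?thesis using sub[OF that] P[OF that] by blast
  qed
  then have "covers m c T \<sigma> Ps"
    using magP lenP by (auto simp: covers_def)
  then have "min_switches m c T \<sigma> \<le> switches Ps"
    by (rule min_switches_le)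
  moreover have "loads {} Ps = switches Ps + c"
    using magP lenP assms(3) by (intro loads_eq_switches) (auto simp: magazine_def)
  moreover have "loads {} Ms = switches Ms + c"
    using mag ne by (intro loads_eq_switches) auto
  moreover have "loads {} ?Ns + card (last Ms - ?U) \<le> loads {} Ms"
    using fin ne by (intro loads_restrict) auto
  ultimately show ?thesis using le by linarith
qed

lemma L4_le_switches:
  assumes inst: "ssp_instance m n c T" and "\<sigma> \<noteq> []"
    and perm: "set (\<sigma> @ \<rho>) = {1..n}"
    and cov: "covers m c T (\<sigma> @ \<rho>) Ms"
  shows "L4 m n c T \<sigma> \<le> int (switches Ms)"
proof -
  let ?U = "used_tools T \<sigma>" and ?A = "active_tools n T \<sigma>"
  define Hs Ks where "Hs = take (length \<sigma>) Ms" and "Ks = drop (length \<sigma>) Ms"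
  have len: "length Ms = length \<sigma> + length \<rho>"
    and mag: "\<And>M. M \<in> set Ms \<Longrightarrow> M \<subseteq> {1..m} \<and> card M = c"
    and sub: "\<And>i. i < length (\<sigma> @ \<rho>) \<Longrightarrow> T ((\<sigma> @ \<rho>) ! i) \<subseteq> Ms ! i"
    using cov by (auto simp: covers_def magazine_def)
  have Ms: "Ms = Hs @ Ks" and lens: "length Hs = length \<sigma>" "length Ks = length \<rho>"
    using len by (auto simp: Hs_def Ks_def)
  have fin: "finite M" if "M \<in> set Ms" for M
    using mag[OF that] finite_subset by blast
  have Hs: "Hs \<noteq> []" using lens assms(2) by auto
  then have lastHs: "last Hs \<in> set Ms" by (simp add: Ms)
  have subH: "T (\<sigma> ! i) \<subseteq> Hs ! i" if "i < length \<sigma>" for i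
    using sub[of i] that lens by (simp add: Ms nth_append)
  have subK: "T (\<rho> ! i) \<subseteq> Ks ! i" if "i < length \<rho>" for i
    using sub[of "length \<sigma> + i"] that lens by (simp add: Ms nth_append)
  have covH: "covers m c T \<sigma> Hs"
    using lens subH mag by (auto simp: covers_def magazine_def Ms)
  have c: "c \<le> m" using inst by (simp add: ssp_instance_def)
  have head: "min_switches m c T \<sigma> + card (last Hs - ?U) \<le> switches Hs + (c - card ?U)"
    using switches_ge_unused_tools[OF covH c assms(2)] .
  have "T (last \<sigma>) \<subseteq> last Hs"
    using subH[of "length \<sigma> - 1"] assms(2) lens Hs by (simp add: last_conv_nth)
  moreover have "T j \<subseteq> \<Union> (set Ks)" if "j \<in> {1..n} - set \<sigma>" for j
  proof -
    have "j \<in> set \<rho>" using that unfolding perm[symmetric] by auto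
    then obtain i where i: "i < length \<rho>" "j = \<rho> ! i" by (auto simp: in_set_conv_nth)
    then have "Ks ! i \<in> set Ks" using lens by simp
    then show ?thesis using subK[OF i(1)] i(2) by blast
  qed
  ultimately have A: "?A \<subseteq> last Hs \<union> \<Union> (set Ks)"
    unfolding active_tools_def by blast
  have finA: "finite ?A"
    using fin lastHs by (intro finite_subset[OF A]) (auto simp: Ms)
  have "card (?A - last Hs) \<le> card (\<Union> (set Ks) - last Hs)"
    using A fin by (intro card_mono) (auto simp: Ms)
  also have "\<dots> \<le> loads (last Hs) Ks"
    using fin by (intro card_Union_le_loads) (auto simp: Ms)
  finally have "card (?A - last Hs) + switches Hs \<le> switches Ms"
    using Hs by (simp add: Ms switches_append)
  moreover have "card ?A = card (?A - last Hs) + card (?A \<inter> last Hs)"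
    using finA card_Diff_subset_Int[of ?A "last Hs"] card_mono[of ?A "?A \<inter> last Hs"] by simp
  ultimately have tail: "switches Hs + card ?A \<le> switches Ms + card (?A \<inter> last Hs)"
    by linarith
  have "card (?A \<inter> last Hs) \<le> card (last Hs)"
    using fin lastHs by (intro card_mono) auto
  then have le_c: "card (?A \<inter> last Hs) \<le> c" using mag[OF lastHs] by simp
  have "card (?A \<inter> last Hs) \<le> card ((?U \<inter> ?A) \<union> (last Hs - ?U))"
    using finA fin lastHs by (intro card_mono) auto
  also have "\<dots> \<le> card (?U \<inter> ?A) + card (last Hs - ?U)"
    by (rule card_Un_le)
  finally have le_s: "card (?A \<inter> last Hs) \<le> card (?U \<inter> ?A) + card (last Hs - ?U)" .
  have "min_switches m c T \<sigma> \<le> switches Hs" by (rule min_switches_le[OF covH])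
  then show ?thesis
    using head tail le_c le_s unfolding L4_def s_bound_def by linarith
qed

theorem proposition4:
  fixes m n c :: nat and T :: "nat \<Rightarrow> nat set" and \<sigma> :: "nat list"
  assumes "ssp_instance m n c T"
    and "pe_node n \<sigma>"
    and "length \<sigma> \<ge> 1"
  shows "L4 m n c T \<sigma> \<le> int (subproblem_opt m n c T \<sigma>) \<and>
    (\<forall>\<tau>\<in>completions n \<sigma>. L4 m n c T \<sigma> \<le> int (min_switches m c T \<tau>))"
proof -
  have all: "L4 m n c T \<sigma> \<le> int (min_switches m c T \<tau>)" if compl: "\<tau> \<in> completions n \<sigma>" for \<tau>
  proof -
    obtain \<rho> where \<tau>: "\<tau> = \<sigma> @ \<rho>" and set: "set (\<sigma> @ \<rho>) = {1..n}"
      using compl by (auto simp: completions_def permutations_of_set_def prefix_def)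
    obtain Ms where Ms: "covers m c T \<tau> Ms" "switches Ms = min_switches m c T \<tau>"
      using min_switches_attained[OF assms(1), of \<tau>] set \<tau> by auto
    have "\<sigma> \<noteq> []" using assms(3) by auto
    then show ?thesis
      using L4_le_switches[OF assms(1) _ set] Ms \<tau> by metis
  qed
  have "subproblem_opt m n c T \<sigma> \<in> min_switches m c T ` completions n \<sigma>"
    unfolding subproblem_opt_def
    using completions_finite completions_nonempty[OF assms(2)] by (intro Min_in) auto
  then show ?thesis using all by auto
qed

end
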